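(* Let $G=(V,E)$ be a graph and let $X=\{x_1,\dots,x_{2\ell+1}\}$ where $x_i\in\mathcal{P}(G)$ for every $i$. Suppose $\|\mathrm{median}\{x_i: x_i\in X\}\|_1>0$. Then $R_{\mathrm{med}}(G,X)\in\mathcal{P}(G)$.
   Context: Graphs are finite directed graphs; vertices with no out-edges carry a self-loop. A ranking (reset) vector is $x:V\to[0,1]$ with $\sum_v x[v]=1$. $\mathrm{PR}(G,r,\varepsilon)$ is the unique stationary distribution of the chain with transition matrix $(1-\varepsilon)M+\varepsilon R$, $M[u,v]=1/d_{out}(u)$ for $(u,v)\in E$ (else 0), $R[u,v]=r[v]$. $\mathcal{P}(G)=\{\mathrm{PR}(G,r,\varepsilon): r\text{ a ranking vector},\ \varepsilon\in(0,1)\}$. The median is component-wise, and $R_{\mathrm{med}}(G,X)=\mathrm{median}\{x_i\}/\|\mathrm{median}\{x_i\}\|_1$. *)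

theory Defs
  imports Complex_Main "HOL-Library.FuncSet" "Graph_Theory.Pair_Digraph"
begin

text \<open>
  A vector indexed by the vertices is a real-valued function that is extensional on the vertex set
  (in the sense of \<open>\<rightarrow>\<^sub>E\<close>), so that equality of vectors is equality of functions.
\<close>

definition ranking_vectors :: "'v pair_pre_digraph \<Rightarrow> ('v \<Rightarrow> real) set" where
  "ranking_vectors G = {x \<in> pverts G \<rightarrow>\<^sub>E {0..1}. (\<Sum>v\<in>pverts G. x v) = 1}"

definition walk_matrix :: "'v pair_pre_digraph \<Rightarrow> 'v \<Rightarrow> 'v \<Rightarrow> real" where
  "walk_matrix G u v = (if (u, v) \<in> parcs G then 1 / real (out_degree (with_proj G) u) else 0)"

definition pagerank_matrix ::
    "'v pair_pre_digraph \<Rightarrow> ('v \<Rightarrow> real) \<Rightarrow> real \<Rightarrow> 'v \<Rightarrow> 'v \<Rightarrow> real" where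
  "pagerank_matrix G r \<epsilon> u v = (1 - \<epsilon>) * walk_matrix G u v + \<epsilon> * r v"

definition stationary_distribution ::
    "'v pair_pre_digraph \<Rightarrow> ('v \<Rightarrow> 'v \<Rightarrow> real) \<Rightarrow> ('v \<Rightarrow> real) \<Rightarrow> bool" where
  "stationary_distribution G P x \<longleftrightarrow>
     x \<in> ranking_vectors G \<and> (\<forall>v\<in>pverts G. (\<Sum>u\<in>pverts G. x u * P u v) = x v)"

definition PR :: "'v pair_pre_digraph \<Rightarrow> ('v \<Rightarrow> real) \<Rightarrow> real \<Rightarrow> 'v \<Rightarrow> real" where
  "PR G r \<epsilon> = (THE x. stationary_distribution G (pagerank_matrix G r \<epsilon>) x)"

definition pagerank_vectors :: "'v pair_pre_digraph \<Rightarrow> ('v \<Rightarrow> real) set" where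
  "pagerank_vectors G = {PR G r \<epsilon> | r \<epsilon>. r \<in> ranking_vectors G \<and> 0 < \<epsilon> \<and> \<epsilon> < 1}"

text \<open>The median of a list of odd length (only this case is used).\<close>

definition median :: "real list \<Rightarrow> real" where
  "median ys = sort ys ! (length ys div 2)"

definition median_vector :: "'v pair_pre_digraph \<Rightarrow> ('v \<Rightarrow> real) list \<Rightarrow> 'v \<Rightarrow> real" where
  "median_vector G xs = (\<lambda>v\<in>pverts G. median (map (\<lambda>x. x v) xs))"

definition l1_norm :: "'v pair_pre_digraph \<Rightarrow> ('v \<Rightarrow> real) \<Rightarrow> real" where
  "l1_norm G x = (\<Sum>v\<in>pverts G. \<bar>x v\<bar>)"

definition R_med :: "'v pair_pre_digraph \<Rightarrow> ('v \<Rightarrow> real) list \<Rightarrow> 'v \<Rightarrow> real" where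
  "R_med G xs = (\<lambda>v\<in>pverts G. median_vector G xs v / l1_norm G (median_vector G xs))"

end

theory Submission
  imports Defs
begin

text \<open>
  Because \<open>\<epsilon>\<close> may be chosen freely, a ranking vector \<open>x\<close> is a PageRank vector if and only if its
  support is closed under out-neighbours. Indeed, stationarity gives
  \<open>x v \<ge> (1 - \<epsilon>) x u M u v\<close>; conversely, if the support is closed, then \<open>x \<ge> (1 - \<epsilon>) x M\<close> holds
  componentwise once \<open>\<epsilon>\<close> is close enough to 1, and the reset vector is read off as
  \<open>r = (x - (1 - \<epsilon>) x M) / \<epsilon>\<close>. Closedness of the support passes to the median: if more than half
  of the vectors are positive at \<open>u\<close>, then more than half are positive at every out-neighbour
  of \<open>u\<close>.
\<close>

section \<open>Order statistics and the median\<close>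

lemma sorted_nth_greater_iff:
  fixes s :: "'a::linorder list"
  assumes "sorted s" "k < length s"
  shows "c < s ! k \<longleftrightarrow> length (filter (\<lambda>y. y \<le> c) s) \<le> k"
proof
  assume "c < s ! k"
  \<comment> \<open>In a sorted list the entries that are at most \<open>c\<close> fill an initial
    segment of positions. With indices starting at 0, position \<open>k\<close> lies beyond that
    segment exactly when its length is at most \<open>k\<close>.\<close>
  then have "{i. i < length s \<and> s ! i \<le> c} \<subseteq> {..<k}"
    using assms by (fastforce simp: not_less[symmetric] dest: sorted_nth_mono)
  then show "length (filter (\<lambda>y. y \<le> c) s) \<le> k"
    unfolding length_filter_conv_card using card_mono[of "{..<k}"] by fastforce
next
  assume le: "length (filter (\<lambda>y. y \<le> c) s) \<le> k"
  show "c < s ! k"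
  proof (rule ccontr)
    assume "\<not> c < s ! k"
    then have "{..k} \<subseteq> {i. i < length s \<and> s ! i \<le> c}"
      using assms by (auto dest: sorted_nth_mono)
    then have "card {..k} \<le> card {i. i < length s \<and> s ! i \<le> c}"
      by (intro card_mono) auto
    with le show False
      by (simp add: length_filter_conv_card)
  qed
qed

text \<open>Counting ignores the order of the entries, so the \<open>sort\<close> in the definition
  drops out and medians of different coordinates can be compared by counting alone.\<close>

lemma median_greater_iff:
  assumes "ys \<noteq> []"
  shows "c < median ys \<longleftrightarrow> length (filter (\<lambda>y. y \<le> c) ys) \<le> length ys div 2"
proof -
  have "length (filter (\<lambda>y. y \<le> c) (sort ys)) = length (filter (\<lambda>y. y \<le> c) ys)"
    by (simp add: filter_sort)
  moreover have "length ys div 2 < length (sort ys)"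
    using assms by simp
  ultimately show ?thesis
    unfolding median_def by (simp add: sorted_nth_greater_iff)
qed

lemma median_in_set: "ys \<noteq> [] \<Longrightarrow> median ys \<in> set ys"
  unfolding median_def by (metis length_sort nth_mem set_sort length_greater_0_conv div_less_dividend
      one_less_numeral_iff semiring_norm(76))

lemma length_filter_mono:
  "(\<And>x. x \<in> set xs \<Longrightarrow> P x \<Longrightarrow> Q x) \<Longrightarrow> length (filter P xs) \<le> length (filter Q xs)"
  by (induction xs) (auto simp: le_SucI)

lemma median_map_pos_mono:
  assumes "xs \<noteq> []" "\<And>x. x \<in> set xs \<Longrightarrow> 0 < f x \<Longrightarrow> 0 < g x" "0 < median (map f xs)"
  shows "0 < median (map g xs)"
proof -
  have "length (filter (\<lambda>x. g x \<le> 0) xs) \<le> length (filter (\<lambda>x. f x \<le> 0) xs)"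
    using assms(2) by (intro length_filter_mono) (meson not_less)
  then show ?thesis
    using assms(1,3) by (simp add: median_greater_iff filter_map o_def)
qed

section \<open>Ranking vectors and one step of the walk\<close>

lemma ranking_vectorsI:
  assumes "finite (pverts G)" "x \<in> extensional (pverts G)" "\<And>v. v \<in> pverts G \<Longrightarrow> 0 \<le> x v"
    and "(\<Sum>v\<in>pverts G. x v) = 1"
  shows "x \<in> ranking_vectors G"
proof -
  have "x v \<le> 1" if "v \<in> pverts G" for v
    using member_le_sum[of v "pverts G" x] assms that by auto
  then show ?thesis
    using assms by (auto simp: ranking_vectors_def PiE_iff)
qed

lemma ranking_vectorsD:
  assumes "x \<in> ranking_vectors G"
  shows "v \<in> pverts G \<Longrightarrow> 0 \<le> x v" "v \<in> pverts G \<Longrightarrow> x v \<le> 1"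
    "(\<Sum>v\<in>pverts G. x v) = 1" "x \<in> extensional (pverts G)"
  using assms by (auto simp: ranking_vectors_def PiE_iff)

text \<open>The row vector \<open>x\<close> times M. Restricting it to the vertices keeps the result
  extensional, so that it can be iterated inside \<open>ranking_vectors G\<close>.\<close>

definition walk_step :: "'v pair_pre_digraph \<Rightarrow> ('v \<Rightarrow> real) \<Rightarrow> 'v \<Rightarrow> real" where
  "walk_step G x = (\<lambda>v\<in>pverts G. \<Sum>u\<in>pverts G. x u * walk_matrix G u v)"

lemma walk_matrix_nonneg: "0 \<le> walk_matrix G u v"
  by (simp add: walk_matrix_def)

text \<open>Every row of R equals \<open>r\<close>, so R sends any vector of total mass 1 to
  \<open>r\<close>. Stationarity thus becomes an affine fixed-point equation.\<close>

lemma stationary_distribution_pagerank_iff: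
  "stationary_distribution G (pagerank_matrix G r \<epsilon>) x \<longleftrightarrow>
     x \<in> ranking_vectors G \<and> (\<forall>v\<in>pverts G. x v = (1 - \<epsilon>) * walk_step G x v + \<epsilon> * r v)"
proof -
  have "(\<Sum>u\<in>pverts G. x u * pagerank_matrix G r \<epsilon> u v) = (1 - \<epsilon>) * walk_step G x v + \<epsilon> * r v"
    if "x \<in> ranking_vectors G" "v \<in> pverts G" for v
  proof -
    have "(\<Sum>u\<in>pverts G. x u * pagerank_matrix G r \<epsilon> u v) =
        (\<Sum>u\<in>pverts G. (1 - \<epsilon>) * (x u * walk_matrix G u v)) + (\<Sum>u\<in>pverts G. x u * (\<epsilon> * r v))"
      unfolding sum.distrib[symmetric]
      by (intro sum.cong) (simp_all add: pagerank_matrix_def algebra_simps)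
    also have "\<dots> = (1 - \<epsilon>) * walk_step G x v + \<epsilon> * r v"
      using that by (simp add: walk_step_def sum_distrib_left[symmetric]
          sum_distrib_right[symmetric] ranking_vectorsD(3))
    finally show ?thesis .
  qed
  then show ?thesis
    unfolding stationary_distribution_def by (auto simp: eq_commute)
qed

text \<open>The self-loop convention enters as \<open>no_sink\<close>: every vertex has an
  out-neighbour, possibly itself. This makes M row-stochastic.\<close>

locale sinkless_digraph = pair_fin_digraph G for G :: "'v pair_pre_digraph" +
  assumes no_sink: "u \<in> pverts G \<Longrightarrow> \<exists>v. (u, v) \<in> parcs G"
begin

lemma out_degree_eq_card: "out_degree (with_proj G) u = card {v. (u, v) \<in> parcs G}"
proof -
  have "out_arcs (with_proj G) u = Pair u ` {v. (u, v) \<in> parcs G}"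
    by (auto simp: out_arcs_def)
  then show ?thesis
    by (simp add: out_degree_def card_image inj_on_def)
qed

lemma finite_out_neighbours: "finite {v. (u, v) \<in> parcs G}"
  by (rule finite_subset[OF _ finite_imageI[OF pair_finite_arcs, of snd]]) force

lemma walk_matrix_pos: "(u, v) \<in> parcs G \<Longrightarrow> 0 < walk_matrix G u v"
  by (auto simp: walk_matrix_def out_degree_eq_card card_gt_0_iff finite_out_neighbours)

lemma walk_matrix_row_sum:
  assumes "u \<in> pverts G"
  shows "(\<Sum>v\<in>pverts G. walk_matrix G u v) = 1"
proof -
  let ?N = "{v. (u, v) \<in> parcs G}"
  have N: "?N \<subseteq> pverts G" "?N \<noteq> {}"
    using no_sink[OF assms] by (auto dest: in_arcsD2)
  have "(\<Sum>v\<in>pverts G. walk_matrix G u v) = (\<Sum>v\<in>?N. walk_matrix G u v)"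
    using N by (intro sum.mono_neutral_right) (auto simp: walk_matrix_def)
  also have "\<dots> = (\<Sum>v\<in>?N. 1 / real (card ?N))"
    by (intro sum.cong) (auto simp: walk_matrix_def out_degree_eq_card)
  also have "\<dots> = 1"
    using N(2) finite_out_neighbours[of u] by simp
  finally show ?thesis .
qed

text \<open>Exchanging the sums leaves the row sums of M, which are 1. No sign or mass condition is
  put on \<open>x\<close>, so the result also applies to a vector of absolute differences.\<close>

lemma sum_walk_step: "(\<Sum>v\<in>pverts G. walk_step G x v) = (\<Sum>v\<in>pverts G. x v)"
proof -
  have "(\<Sum>v\<in>pverts G. walk_step G x v) =
      (\<Sum>u\<in>pverts G. \<Sum>v\<in>pverts G. x u * walk_matrix G u v)"
    unfolding walk_step_def by (subst sum.swap) simp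
  then show ?thesis
    by (simp add: sum_distrib_left[symmetric] walk_matrix_row_sum)
qed

lemma walk_step_ranking:
  assumes "x \<in> ranking_vectors G"
  shows "walk_step G x \<in> ranking_vectors G"
proof (rule ranking_vectorsI)
  show "(\<Sum>v\<in>pverts G. walk_step G x v) = 1"
    using ranking_vectorsD(3)[OF assms] by (simp add: sum_walk_step)
qed (auto simp: walk_step_def ranking_vectorsD[OF assms] walk_matrix_nonneg intro!: sum_nonneg)

section \<open>Uniqueness and existence of the stationary distribution\<close>

lemma stationary_distribution_pagerank_unique:
  assumes "0 < \<epsilon>" "\<epsilon> < 1"
    and x: "stationary_distribution G (pagerank_matrix G r \<epsilon>) x"
    and y: "stationary_distribution G (pagerank_matrix G r \<epsilon>) y"
  shows "x = y"
proof -
  note x = x[unfolded stationary_distribution_pagerank_iff]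
  note y = y[unfolded stationary_distribution_pagerank_iff]
  \<comment> \<open>The reset term cancels in the difference. Passing to absolute values and summing
    over the vertices gives S \<le> (1 - \<epsilon>) S for the l1 distance S of \<open>x\<close> and
    \<open>y\<close>, which forces S = 0.\<close>
  define d where "d v = x v - y v" for v
  have "\<bar>d v\<bar> \<le> (1 - \<epsilon>) * walk_step G (\<lambda>u. \<bar>d u\<bar>) v" if v: "v \<in> pverts G" for v
  proof -
    have "x v = (1 - \<epsilon>) * walk_step G x v + \<epsilon> * r v" "y v = (1 - \<epsilon>) * walk_step G y v + \<epsilon> * r v"
      using x y v by blast+
    then have "d v = (1 - \<epsilon>) * (walk_step G x v - walk_step G y v)"
      unfolding d_def by (simp add: algebra_simps)
    also have "walk_step G x v - walk_step G y v = (\<Sum>u\<in>pverts G. d u * walk_matrix G u v)"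
      using v by (simp add: walk_step_def d_def sum_subtractf algebra_simps)
    finally have "\<bar>d v\<bar> = (1 - \<epsilon>) * \<bar>\<Sum>u\<in>pverts G. d u * walk_matrix G u v\<bar>"
      using assms by (simp add: abs_mult)
    also have "\<dots> \<le> (1 - \<epsilon>) * (\<Sum>u\<in>pverts G. \<bar>d u * walk_matrix G u v\<bar>)"
      using assms by (intro mult_left_mono sum_abs) simp
    finally show ?thesis
      using v by (simp add: walk_step_def abs_mult walk_matrix_nonneg)
  qed
  then have "(\<Sum>v\<in>pverts G. \<bar>d v\<bar>) \<le> (\<Sum>v\<in>pverts G. (1 - \<epsilon>) * walk_step G (\<lambda>u. \<bar>d u\<bar>) v)"
    by (rule sum_mono)
  also have "\<dots> = (1 - \<epsilon>) * (\<Sum>v\<in>pverts G. \<bar>d v\<bar>)"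
    by (simp add: sum_distrib_left[symmetric] sum_walk_step)
  finally have "\<epsilon> * (\<Sum>v\<in>pverts G. \<bar>d v\<bar>) \<le> 0"
    by (simp add: algebra_simps)
  then have "(\<Sum>v\<in>pverts G. \<bar>d v\<bar>) \<le> 0"
    using assms by (simp add: mult_le_0_iff)
  then have "(\<Sum>v\<in>pverts G. \<bar>d v\<bar>) = 0"
    by (simp add: order_antisym sum_nonneg)
  then have "x v = y v" if "v \<in> pverts G" for v
    using that by (simp add: sum_nonneg_eq_0_iff d_def)
  then show ?thesis
    using x y by (intro extensionalityI[of _ "pverts G"]) (auto dest: ranking_vectorsD(4))
qed

lemma stationary_distribution_pagerank_exists:
  assumes "0 < \<epsilon>" "\<epsilon> < 1" and r: "r \<in> ranking_vectors G"
  shows "\<exists>x. stationary_distribution G (pagerank_matrix G r \<epsilon>) x"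
proof -
  \<comment> \<open>The Neumann series of \<open>\<epsilon> r (I - (1 - \<epsilon>) M)\<^sup>-\<^sup>1\<close>.\<close>
  define y where "y k = (walk_step G ^^ k) r" for k
  define t where "t v k = \<epsilon> * (1 - \<epsilon>) ^ k * y k v" for v k
  define x where "x = (\<lambda>v\<in>pverts G. \<Sum>k. t v k)"
  have y: "y k \<in> ranking_vectors G" for k
    unfolding y_def by (induction k) (simp_all add: r walk_step_ranking)
  have geo: "(\<lambda>k. \<epsilon> * (1 - \<epsilon>) ^ k) sums 1"
    using sums_mult[OF geometric_sums[of "1 - \<epsilon>"], of \<epsilon>] assms by simp
  have t_nonneg: "0 \<le> t v k" if "v \<in> pverts G" for v k
    using that assms by (simp add: t_def ranking_vectorsD(1)[OF y])
  have summ: "summable (t v)" if "v \<in> pverts G" for v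
  proof (rule summable_comparison_test[OF _ sums_summable[OF geo]], intro exI allI impI)
    fix k
    have "t v k \<le> \<epsilon> * (1 - \<epsilon>) ^ k"
      unfolding t_def using assms ranking_vectorsD(2)[OF y that] by (simp add: mult_left_le)
    then show "norm (t v k) \<le> \<epsilon> * (1 - \<epsilon>) ^ k"
      using t_nonneg[OF that] by simp
  qed
  have x_sums: "t v sums x v" if "v \<in> pverts G" for v
    using summable_sums[OF summ[OF that]] that by (simp add: x_def)
  have "x \<in> ranking_vectors G"
  proof (rule ranking_vectorsI)
    show "0 \<le> x v" if "v \<in> pverts G" for v
      using that summ t_nonneg by (simp add: x_def suminf_nonneg)
    have "(\<lambda>k. \<Sum>v\<in>pverts G. t v k) sums (\<Sum>v\<in>pverts G. x v)"
      by (rule sums_sum) (rule x_sums)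
    \<comment> \<open>Each iterate \<open>y k\<close> has mass 1, so summing over the vertices
      leaves the geometric series, whose value is 1.\<close>
    moreover have "(\<Sum>v\<in>pverts G. t v k) = \<epsilon> * (1 - \<epsilon>) ^ k" for k
      by (simp add: t_def sum_distrib_left[symmetric] ranking_vectorsD(3)[OF y])
    ultimately show "(\<Sum>v\<in>pverts G. x v) = 1"
      using geo by (simp add: sums_unique2)
  qed (simp_all add: x_def)
  moreover have "x v = (1 - \<epsilon>) * walk_step G x v + \<epsilon> * r v" if v: "v \<in> pverts G" for v
  proof -
    have "(\<lambda>k. (1 - \<epsilon>) * (\<Sum>u\<in>pverts G. t u k * walk_matrix G u v)) sums
        ((1 - \<epsilon>) * (\<Sum>u\<in>pverts G. x u * walk_matrix G u v))"
      by (intro sums_mult sums_sum sums_mult2 x_sums)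
    \<comment> \<open>Applying (1 - \<epsilon>) M shifts the series by one index; the missing term
      \<open>t v 0\<close> is exactly the reset term \<open>\<epsilon> * r v\<close>.\<close>
    moreover have "(1 - \<epsilon>) * (\<Sum>u\<in>pverts G. t u k * walk_matrix G u v) = t v (Suc k)" for k
      using v by (simp add: t_def y_def walk_step_def sum_distrib_left mult_ac)
    ultimately have "(\<lambda>k. t v (Suc k)) sums ((1 - \<epsilon>) * walk_step G x v)"
      using v by (simp add: walk_step_def)
    then have "t v sums ((1 - \<epsilon>) * walk_step G x v + t v 0)"
      by (rule sums_Suc)
    then show ?thesis
      using x_sums[OF v] sums_unique2 by (fastforce simp: t_def y_def)
  qed
  ultimately show ?thesis
    unfolding stationary_distribution_pagerank_iff by blast
qed

lemma PR_eqI: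
  assumes "0 < \<epsilon>" "\<epsilon> < 1" "stationary_distribution G (pagerank_matrix G r \<epsilon>) x"
  shows "PR G r \<epsilon> = x"
  unfolding PR_def using assms stationary_distribution_pagerank_unique by blast

text \<open>Eliminates the \<open>THE\<close> in \<open>PR\<close>: existence and uniqueness
  together make \<open>PR G r \<epsilon>\<close> a stationary distribution, and uniqueness
  identifies any given one with it.\<close>

lemma pagerank_vectors_iff_stationary:
  "x \<in> pagerank_vectors G \<longleftrightarrow> (\<exists>r \<epsilon>. r \<in> ranking_vectors G \<and> 0 < \<epsilon> \<and> \<epsilon> < 1 \<and>
     stationary_distribution G (pagerank_matrix G r \<epsilon>) x)"
  unfolding pagerank_vectors_def
  using PR_eqI stationary_distribution_pagerank_exists by fastforce

section \<open>PageRank vectors as ranking vectors with closed support\<close>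

lemma pagerank_vector_if_support_closed:
  assumes x: "x \<in> ranking_vectors G"
    and closed: "\<And>u v. (u, v) \<in> parcs G \<Longrightarrow> 0 < x u \<Longrightarrow> 0 < x v"
  shows "x \<in> pagerank_vectors G"
proof -
  \<comment> \<open>\<delta> plays the role of 1 - \<epsilon>. It is at most every positive entry of
    \<open>x\<close>, and the entry 1/2 keeps it below 1 and the set nonempty.\<close>
  define \<delta> where "\<delta> = Min (insert (1/2) {x v | v. v \<in> pverts G \<and> 0 < x v})"
  have fin: "finite (insert (1/2) {x v | v. v \<in> pverts G \<and> 0 < x v})"
    by simp
  have \<delta>: "0 < \<delta>" "\<delta> \<le> 1/2"
    unfolding \<delta>_def using fin by (subst Min_gr_iff; auto) (intro Min_le; simp)
  have \<delta>_le: "\<delta> \<le> x v" if "v \<in> pverts G" "0 < x v" for v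
    unfolding \<delta>_def using fin that by (intro Min_le) auto
  note step = ranking_vectorsD[OF walk_step_ranking[OF x]]
  have ineq: "\<delta> * walk_step G x v \<le> x v" if v: "v \<in> pverts G" for v
  proof (cases "0 < x v")
    case True
    have "\<delta> * walk_step G x v \<le> \<delta>"
      using step(2)[OF v] \<delta> by (simp add: mult_left_le)
    then show ?thesis
      using \<delta>_le[OF v True] by simp
  next
    case False
    \<comment> \<open>Closedness, read backwards: when \<open>x v\<close> vanishes, no in-neighbour
      of \<open>v\<close> carries mass, so none flows into \<open>v\<close>.\<close>
    have "x u * walk_matrix G u v = 0" if "u \<in> pverts G" for u
      using closed[of u v] False ranking_vectorsD(1)[OF x that]
      by (cases "0 < x u") (auto simp: walk_matrix_def)
    then have "walk_step G x v = 0"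
      using v by (simp add: walk_step_def del: mult_eq_0_iff)
    then show ?thesis
      using ranking_vectorsD(1)[OF x v] by simp
  qed
  \<comment> \<open>The fixed-point equation solved for the reset vector. Its mass is 1 because
    \<open>x\<close> and its image under the walk both have mass 1.\<close>
  define r where "r = (\<lambda>v\<in>pverts G. (x v - \<delta> * walk_step G x v) / (1 - \<delta>))"
  have "r \<in> ranking_vectors G"
  proof (rule ranking_vectorsI)
    show "0 \<le> r v" if "v \<in> pverts G" for v
      using that ineq[OF that] \<delta> by (simp add: r_def)
    show "(\<Sum>v\<in>pverts G. r v) = 1"
      using \<delta> by (simp add: r_def sum_divide_distrib[symmetric] sum_subtractf
          sum_distrib_left[symmetric] step(3) ranking_vectorsD(3)[OF x])
  qed (simp_all add: r_def)
  moreover have "stationary_distribution G (pagerank_matrix G r (1 - \<delta>)) x"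
    unfolding stationary_distribution_pagerank_iff using x \<delta> by (simp add: r_def)
  ultimately show ?thesis
    unfolding pagerank_vectors_iff_stationary using \<delta> by (intro exI[of _ r] exI[of _ "1 - \<delta>"]) simp
qed

lemma pagerank_vector_support_closed:
  assumes "x \<in> pagerank_vectors G" "(u, v) \<in> parcs G" "0 < x u"
  shows "0 < x v"
proof -
  obtain r \<epsilon> where r: "r \<in> ranking_vectors G" and \<epsilon>: "0 < \<epsilon>" "\<epsilon> < 1"
    and st: "stationary_distribution G (pagerank_matrix G r \<epsilon>) x"
    using assms(1) unfolding pagerank_vectors_iff_stationary by blast
  note st = st[unfolded stationary_distribution_pagerank_iff]
  have uv: "u \<in> pverts G" "v \<in> pverts G"
    using assms(2) by (auto dest: in_arcsD1 in_arcsD2)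
  have "0 < x u * walk_matrix G u v"
    using assms(3) walk_matrix_pos[OF assms(2)] by simp
  \<comment> \<open>All summands are nonnegative, so the flow along the single arc from
    \<open>u\<close> already makes the inflow to \<open>v\<close> positive.\<close>
  also have "\<dots> \<le> (\<Sum>w\<in>pverts G. x w * walk_matrix G w v)"
    using uv conjunct1[OF st]
    by (intro member_le_sum) (auto simp: ranking_vectorsD(1) walk_matrix_nonneg)
  finally have "0 < (1 - \<epsilon>) * walk_step G x v"
    using uv \<epsilon> by (simp add: walk_step_def)
  moreover have "0 \<le> \<epsilon> * r v"
    using \<epsilon> ranking_vectorsD(1)[OF r uv(2)] by simp
  moreover have "x v = (1 - \<epsilon>) * walk_step G x v + \<epsilon> * r v"
    using st uv(2) by blast
  ultimately show ?thesis
    by linarith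
qed

lemma pagerank_vector_ranking: "x \<in> pagerank_vectors G \<Longrightarrow> x \<in> ranking_vectors G"
  unfolding pagerank_vectors_iff_stationary stationary_distribution_def by blast

section \<open>The normalised median\<close>

theorem R_med_pagerank_vector:
  assumes "X \<noteq> []" and X: "set X \<subseteq> pagerank_vectors G"
    and pos: "0 < l1_norm G (median_vector G X)"
  shows "R_med G X \<in> pagerank_vectors G"
proof (rule pagerank_vector_if_support_closed)
  have med_nonneg: "0 \<le> median_vector G X v" if "v \<in> pverts G" for v
  proof -
    \<comment> \<open>The median is one of the entries, so it inherits their nonnegativity; the l1
      norm is then a plain sum.\<close>
    have "median (map (\<lambda>x. x v) X) \<in> (\<lambda>x. x v) ` set X"
      using median_in_set[of "map (\<lambda>x. x v) X"] \<open>X \<noteq> []\<close> by simp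
    then show ?thesis
      using that X by (fastforce simp: median_vector_def dest: pagerank_vector_ranking
          intro: ranking_vectorsD(1))
  qed
  then have "l1_norm G (median_vector G X) = (\<Sum>v\<in>pverts G. median_vector G X v)"
    by (simp add: l1_norm_def)
  then show "R_med G X \<in> ranking_vectors G"
    using pos med_nonneg
    by (intro ranking_vectorsI) (simp_all add: R_med_def sum_divide_distrib[symmetric])
next
  fix u v
  assume uv: "(u, v) \<in> parcs G" and "0 < R_med G X u"
  have verts: "u \<in> pverts G" "v \<in> pverts G"
    using uv by (auto dest: in_arcsD1 in_arcsD2)
  \<comment> \<open>Dividing by a positive norm leaves the support unchanged, so closedness need
    only be checked for the median itself.\<close>
  have "0 < median (map (\<lambda>x. x u) X)"
    using \<open>0 < R_med G X u\<close> pos verts by (simp add: R_med_def median_vector_def zero_less_divide_iff)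
  then have "0 < median (map (\<lambda>x. x v) X)"
    by (rule median_map_pos_mono[OF \<open>X \<noteq> []\<close>, rotated])
      (use X uv in \<open>blast intro: pagerank_vector_support_closed\<close>)
  then show "0 < R_med G X v"
    using pos verts by (simp add: R_med_def median_vector_def)
qed

end

theorem theorem21:
  fixes G :: "'v pair_pre_digraph" and X :: "('v \<Rightarrow> real) list" and l :: nat
  assumes "pair_fin_digraph G"
    and "\<forall>u\<in>pverts G. \<exists>v. (u, v) \<in> parcs G"
    and "length X = 2 * l + 1"
    and "\<forall>x\<in>set X. x \<in> pagerank_vectors G"
    and "l1_norm G (median_vector G X) > 0"
  shows "R_med G X \<in> pagerank_vectors G"
proof -
  interpret pair_fin_digraph G by fact
  interpret sinkless_digraph G
    using assms(2) by unfold_locales blast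
  have "X \<noteq> []"
    using assms(3) by auto
  then show ?thesis
    using assms(4,5) by (intro R_med_pagerank_vector) auto
qed

end
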